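(* Let $n\ge1$, let $R$ be a real linear operator on $\mathbb{C}^n$ with characteristic polynomial $p$ and coefficient matrix $H$, and let $F:\mathbb{C}\to\mathbb{R}$ be the numerical function of $R$. Let $H=U^*DU$ with $D=\operatorname{diag}(d_0,\dots,d_n)$ real diagonal and $U=[u_{ij}]_{i,j=0}^n$ unitary, and let $p_i(\lambda)=\sum_{j=0}^n u_{ij}\lambda^j$ for $i=0,\dots,n$. Then the following hold. (i) $F$ is continuous and its range is a subset of $W(H)$. (ii) $F(\lambda)=0$ if and only if $p(\lambda,\overline\lambda)=0$. (iii) For every $\lambda\in\mathbb{C}$, $F(\lambda)$ is a convex combination of eigenvalues of $H$: $$F(\lambda)=\sum_{i=0}^n d_i\,\frac{|p_i(\lambda)|^2}{\sum_{j=0}^n|p_j(\lambda)|^2}.$$ (iv) In particular, $$F(0)=\det R^{\mathbb{C}}=\sum_{i=0}^n d_i|u_{i0}|^2,\qquad \lim_{|\lambda|\to\infty}F(\lambda)=\sum_{i=0}^n d_i|u_{in}|^2=1,$$ so that $$[\det R^{\mathbb{C}},1)\subset F(\mathbb{C})\subset W(H)=[\lambda_{\min}(H),\lambda_{\max}(H)],$$ where $\lambda_{\min}(H)$ and $\lambda_{\max}(H)$ are the smallest and greatest eigenvalues of $H$.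
   Context: A map $R:\mathbb{C}^n\to\mathbb{C}^n$ is real linear if it is additive and $R(rx)=rRx$ for $r\in\mathbb{R}$. Every such $R$ is represented uniquely as $R=C+B\tau$ with $C,B\in\mathbb{C}^{n\times n}$, where $\tau z=\overline z$ is componentwise complex conjugation. Its complexification is the matrix $$R^{\mathbb{C}}=\begin{bmatrix} C & B\\ \overline B & \overline C\end{bmatrix}\in\mathbb{C}^{2n\times 2n},$$ where the bar denotes entrywise conjugation. The characteristic polynomial of $R$ is $$p(\lambda,\overline\lambda)=\det (R-\lambda)^{\mathbb{C}}=\det\begin{bmatrix} C-\lambda & B\\ \overline B & \overline{C-\lambda}\end{bmatrix}.$$ It can be written uniquely as $\sum_{i,j=0}^n h_{ij}\lambda^j\overline\lambda^i=v_\lambda^*Hv_\lambda$, where $v_\lambda=(1,\lambda,\dots,\lambda^n)\in\mathbb{C}^{n+1}$ and $H=[h_{ij}]_{i,j=0}^n$ is the coefficient matrix; $p$ is real valued and $H$ is Hermitian. The numerical function of $R$ is $$F:\mathbb{C}\to\mathbb{R},\qquad F(\lambda)=\frac{p(\lambda,\overline\lambda)}{\sum_{j=0}^n|\lambda|^{2j}}=\frac{v_\lambda^*Hv_\lambda}{\|v_\lambda\|^2}.$$ The field of values (numerical range) of a matrix $M\in\mathbb{C}^{m\times m}$ is $W(M)=\{x^*Mx : x\in\mathbb{C}^m,\ \|x\|=1\}$. An interval $[a,1)$ with $a\ge1$ is empty. *)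

theory Defs
  imports Complex_Main "Jordan_Normal_Form.Spectral_Radius"
begin

section \<open>Real linear operators\<close>

definition real_linear_op :: "nat \<Rightarrow> (complex vec \<Rightarrow> complex vec) \<Rightarrow> bool" where
  "real_linear_op n R \<longleftrightarrow>
     (\<forall>x\<in>carrier_vec n. R x \<in> carrier_vec n) \<and>
     (\<forall>x\<in>carrier_vec n. \<forall>y\<in>carrier_vec n. R (x + y) = R x + R y) \<and>
     (\<forall>r::real. \<forall>x\<in>carrier_vec n. R (complex_of_real r \<cdot>\<^sub>v x) = complex_of_real r \<cdot>\<^sub>v R x)"

definition represents :: "nat \<Rightarrow> (complex vec \<Rightarrow> complex vec) \<Rightarrow> complex mat \<Rightarrow> complex mat \<Rightarrow> bool" where
  "represents n R C B \<longleftrightarrow>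
     C \<in> carrier_mat n n \<and> B \<in> carrier_mat n n \<and>
     (\<forall>x\<in>carrier_vec n. R x = C *\<^sub>v x + B *\<^sub>v conjugate x)"

definition block_complexification :: "complex mat \<Rightarrow> complex mat \<Rightarrow> complex mat" where
  "block_complexification C B = four_block_mat C B (map_mat cnj B) (map_mat cnj C)"

text \<open>The description is proper for every real linear operator: see
  \<open>represents_exists\<close>, \<open>represents_unique\<close> and \<open>complexification_eq\<close> below.\<close>

definition complexification :: "nat \<Rightarrow> (complex vec \<Rightarrow> complex vec) \<Rightarrow> complex mat" where
  "complexification n R = (THE M. \<exists>C B. represents n R C B \<and> M = block_complexification C B)"

text \<open>The polynomial \<open>p(\<lambda>, cnj \<lambda>)\<close>, regarded as a function of \<open>\<lambda>\<close>.\<close>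

definition rl_charpoly :: "nat \<Rightarrow> (complex vec \<Rightarrow> complex vec) \<Rightarrow> complex \<Rightarrow> complex" where
  "rl_charpoly n R z = Determinant.det (complexification n (\<lambda>x. R x - z \<cdot>\<^sub>v x))"

definition is_coeff_matrix :: "nat \<Rightarrow> (complex \<Rightarrow> complex) \<Rightarrow> complex mat \<Rightarrow> bool" where
  "is_coeff_matrix n p H \<longleftrightarrow>
     H \<in> carrier_mat (n + 1) (n + 1) \<and>
     (\<forall>z. p z = (\<Sum>i\<le>n. \<Sum>j\<le>n. H $$ (i, j) * z ^ j * cnj z ^ i))"

text \<open>The description is proper: see \<open>coeff_matrix_ex1\<close>.\<close>

definition coeff_matrix :: "nat \<Rightarrow> (complex vec \<Rightarrow> complex vec) \<Rightarrow> complex mat" where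
  "coeff_matrix n R = (THE H. is_coeff_matrix n (rl_charpoly n R) H)"

text \<open>The characteristic polynomial is real valued (\<open>rl_charpoly_real\<close>), so taking the real
  part only adjusts the type; see \<open>numerical_function_eq\<close>.\<close>

definition numerical_function :: "nat \<Rightarrow> (complex vec \<Rightarrow> complex vec) \<Rightarrow> complex \<Rightarrow> real" where
  "numerical_function n R z = Re (rl_charpoly n R z) / (\<Sum>j\<le>n. cmod z ^ (2 * j))"


section \<open>Field of values, unitary matrices, extreme eigenvalues\<close>

definition euclid_norm :: "complex vec \<Rightarrow> real" where
  "euclid_norm x = sqrt (\<Sum>i<dim_vec x. (cmod (x $ i))\<^sup>2)"

definition field_of_values :: "complex mat \<Rightarrow> complex set" where
  "field_of_values M =
     {conjugate x \<bullet> (M *\<^sub>v x) | x. x \<in> carrier_vec (dim_row M) \<and> euclid_norm x = 1}"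

definition unitary_mat :: "complex mat \<Rightarrow> bool" where
  "unitary_mat U \<longleftrightarrow>
     square_mat U \<and> inverts_mat U (mat_adjoint U) \<and> inverts_mat (mat_adjoint U) U"

text \<open>Used for Hermitian matrices only, whose eigenvalues are all real.\<close>

definition lambda_min :: "complex mat \<Rightarrow> real" where
  "lambda_min M = Min {r. eigenvalue M (complex_of_real r)}"

definition lambda_max :: "complex mat \<Rightarrow> real" where
  "lambda_max M = Max {r. eigenvalue M (complex_of_real r)}"


section \<open>The representation \<open>C + B \<tau>\<close>\<close>

lemma mult_mat_vec_unit:
  fixes A :: "complex mat"
  assumes "A \<in> carrier_mat n n" "k < n"
  shows "A *\<^sub>v (c \<cdot>\<^sub>v unit_vec n k) = c \<cdot>\<^sub>v col A k"
  using assms by (intro eq_vecI) (auto simp: mult_mat_vec)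

lemma conjugate_smult_unit_vec:
  "conjugate ((c::complex) \<cdot>\<^sub>v unit_vec n k) = cnj c \<cdot>\<^sub>v unit_vec n k"
  by (intro eq_vecI) (auto simp: unit_vec_def)

lemma represents_unique:
  assumes 1: "represents n R C B" and 2: "represents n R C' B'"
  shows "C = C' \<and> B = B'"
proof -
  have dims: "C \<in> carrier_mat n n" "B \<in> carrier_mat n n" "C' \<in> carrier_mat n n" "B' \<in> carrier_mat n n"
    using 1 2 by (auto simp: represents_def)
  have key: "c * C $$ (i,k) + cnj c * B $$ (i,k) = c * C' $$ (i,k) + cnj c * B' $$ (i,k)"
    if ik: "i < n" "k < n" for i k c
  proof -
    let ?e = "c \<cdot>\<^sub>v unit_vec n k :: complex vec"
    have "?e \<in> carrier_vec n" by simp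
    hence "C *\<^sub>v ?e + B *\<^sub>v conjugate ?e = C' *\<^sub>v ?e + B' *\<^sub>v conjugate ?e"
      using 1 2 unfolding represents_def by metis
    hence "c \<cdot>\<^sub>v col C k + cnj c \<cdot>\<^sub>v col B k = c \<cdot>\<^sub>v col C' k + cnj c \<cdot>\<^sub>v col B' k"
      using dims ik by (simp add: conjugate_smult_unit_vec mult_mat_vec_unit)
    from arg_cong[OF this, of "\<lambda>v. v $ i"] show ?thesis
      using dims ik by auto
  qed
  have "C $$ (i,k) = C' $$ (i,k) \<and> B $$ (i,k) = B' $$ (i,k)" if ik: "i < n" "k < n" for i k
    using key[OF ik, of 1] key[OF ik, of \<i>] by (auto simp: complex_eq_iff)
  thus ?thesis using dims by (auto intro!: eq_matI)
qed

lemma real_linear_op_expand: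
  assumes R: "real_linear_op n R" and m: "m \<le> n"
    and z: "z \<in> carrier_vec n" "\<And>i. m \<le> i \<Longrightarrow> i < n \<Longrightarrow> z $ i = 0" and i: "i < n"
  shows "R z $ i = (\<Sum>k<m. Re (z $ k) * R (unit_vec n k) $ i + Im (z $ k) * R (\<i> \<cdot>\<^sub>v unit_vec n k) $ i)"
  using m z
proof (induction m arbitrary: z)
  case 0
  have "R (complex_of_real 0 \<cdot>\<^sub>v 0\<^sub>v n) = complex_of_real 0 \<cdot>\<^sub>v R (0\<^sub>v n)"
    using R zero_carrier_vec[of n] unfolding real_linear_op_def by blast
  moreover have "R (0\<^sub>v n) \<in> carrier_vec n" using R unfolding real_linear_op_def by auto
  moreover have "(0::complex) \<cdot>\<^sub>v 0\<^sub>v n = 0\<^sub>v n" by (intro eq_vecI) auto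
  ultimately have "R (0\<^sub>v n) $ i = 0" using i by (auto dest!: arg_cong[of _ _ "\<lambda>v. v $ i"])
  moreover have "z = 0\<^sub>v n" using 0 by (intro eq_vecI) auto
  ultimately show ?case by simp
next
  case (Suc m)
  let ?e = "unit_vec n m :: complex vec"
  define w where "w = vec n (\<lambda>i. if i = m then 0 else z $ i)"
  have w: "w \<in> carrier_vec n" by (simp add: w_def)
  have add: "R (x + y) = R x + R y" if "x \<in> carrier_vec n" "y \<in> carrier_vec n" for x y
    using R that unfolding real_linear_op_def by blast
  have sc: "R (complex_of_real r \<cdot>\<^sub>v x) = complex_of_real r \<cdot>\<^sub>v R x" if "x \<in> carrier_vec n" for x r
    using R that unfolding real_linear_op_def by blast
  have cl: "R x \<in> carrier_vec n" if "x \<in> carrier_vec n" for x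
    using R that unfolding real_linear_op_def by blast
  have zeq: "z = w + (complex_of_real (Re (z $ m)) \<cdot>\<^sub>v ?e + complex_of_real (Im (z $ m)) \<cdot>\<^sub>v (\<i> \<cdot>\<^sub>v ?e))"
    using Suc.prems by (intro eq_vecI) (auto simp: w_def complex_eq_iff)
  have "R z = R w + (complex_of_real (Re (z $ m)) \<cdot>\<^sub>v R ?e + complex_of_real (Im (z $ m)) \<cdot>\<^sub>v R (\<i> \<cdot>\<^sub>v ?e))"
    by (subst zeq) (simp add: add sc w)
  moreover have "R ?e \<in> carrier_vec n" "R (\<i> \<cdot>\<^sub>v ?e) \<in> carrier_vec n" by (auto intro!: cl)
  ultimately have "R z $ i = R w $ i + (Re (z $ m) * R ?e $ i + Im (z $ m) * R (\<i> \<cdot>\<^sub>v ?e) $ i)"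
    using i cl[OF w] by auto
  moreover have "R w $ i = (\<Sum>k<m. Re (w $ k) * R (unit_vec n k) $ i + Im (w $ k) * R (\<i> \<cdot>\<^sub>v unit_vec n k) $ i)"
    using Suc.prems w by (intro Suc.IH) (auto simp: w_def)
  also have "\<dots> = (\<Sum>k<m. Re (z $ k) * R (unit_vec n k) $ i + Im (z $ k) * R (\<i> \<cdot>\<^sub>v unit_vec n k) $ i)"
    using Suc.prems by (intro sum.cong) (auto simp: w_def)
  ultimately show ?case by simp
qed

lemma mult_mat_vec_index:
  fixes A :: "complex mat"
  assumes "A \<in> carrier_mat n n" "x \<in> carrier_vec n" "i < n"
  shows "(A *\<^sub>v x) $ i = (\<Sum>k<n. A $$ (i, k) * x $ k)"
  using assms by (auto simp: scalar_prod_def lessThan_atLeast0 intro!: sum.cong)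

lemma represents_exists:
  assumes R: "real_linear_op n R"
  shows "\<exists>C B. represents n R C B"
proof -
  let ?a = "\<lambda>k. R (unit_vec n k)" and ?b = "\<lambda>k. R (\<i> \<cdot>\<^sub>v unit_vec n k)"
  define C where "C = mat n n (\<lambda>(i,k). (?a k $ i - \<i> * ?b k $ i) / 2)"
  define B where "B = mat n n (\<lambda>(i,k). (?a k $ i + \<i> * ?b k $ i) / 2)"
  have car: "C \<in> carrier_mat n n" "B \<in> carrier_mat n n" by (simp_all add: C_def B_def)
  have key: "(a - \<i> * b) / 2 * w + (a + \<i> * b) / 2 * cnj w = Re w * a + Im w * b" for a b w :: complex
  proof -
    have "(a - \<i> * b) / 2 * w + (a + \<i> * b) / 2 * cnj w = a * ((w + cnj w) / 2) - \<i> * b * ((w - cnj w) / 2)"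
      by (simp add: field_simps)
    also have "\<dots> = Re w * a + Im w * b"
      unfolding complex_add_cnj complex_diff_cnj by (simp add: mult_ac)
    finally show ?thesis .
  qed
  have "R x = C *\<^sub>v x + B *\<^sub>v conjugate x" if x: "x \<in> carrier_vec n" for x
  proof (rule eq_vecI)
    have "R x \<in> carrier_vec n" using R x unfolding real_linear_op_def by blast
    thus "dim_vec (R x) = dim_vec (C *\<^sub>v x + B *\<^sub>v conjugate x)" by (simp add: B_def)
    fix i assume "i < dim_vec (C *\<^sub>v x + B *\<^sub>v conjugate x)"
    hence i: "i < n" by (simp add: B_def)
    have "(C *\<^sub>v x + B *\<^sub>v conjugate x) $ i =
        (\<Sum>k<n. (?a k $ i - \<i> * ?b k $ i) / 2 * x $ k + (?a k $ i + \<i> * ?b k $ i) / 2 * cnj (x $ k))"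
    proof -
      have "(C *\<^sub>v x + B *\<^sub>v conjugate x) $ i = (C *\<^sub>v x) $ i + (B *\<^sub>v conjugate x) $ i"
        using i by (simp add: B_def)
      also have "(C *\<^sub>v x) $ i = (\<Sum>k<n. C $$ (i,k) * x $ k)"
        by (rule mult_mat_vec_index[OF car(1) x i])
      also have "\<dots> = (\<Sum>k<n. (?a k $ i - \<i> * ?b k $ i) / 2 * x $ k)"
        by (intro sum.cong refl arg_cong2[of _ _ _ _ "(*)"]) (simp only: C_def index_mat i lessThan_iff split)
      also have "(B *\<^sub>v conjugate x) $ i = (\<Sum>k<n. B $$ (i,k) * conjugate x $ k)"
        by (rule mult_mat_vec_index[OF car(2) _ i]) (simp add: x)
      also have "\<dots> = (\<Sum>k<n. (?a k $ i + \<i> * ?b k $ i) / 2 * cnj (x $ k))"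
        using x by (intro sum.cong refl arg_cong2[of _ _ _ _ "(*)"])
          (simp only: B_def index_mat i lessThan_iff split, simp)
      finally show ?thesis unfolding sum.distrib .
    qed
    also have "\<dots> = (\<Sum>k<n. Re (x $ k) * ?a k $ i + Im (x $ k) * ?b k $ i)"
      by (intro sum.cong refl) (rule key)
    also have "\<dots> = R x $ i"
      by (rule real_linear_op_expand[OF R order_refl x _ i, symmetric]) linarith
    finally show "R x $ i = (C *\<^sub>v x + B *\<^sub>v conjugate x) $ i" by simp
  qed
  with car have "represents n R C B" unfolding represents_def by blast
  thus ?thesis by blast
qed

lemma complexification_eq:
  assumes "represents n R C B"
  shows "complexification n R = block_complexification C B"
  unfolding complexification_def
proof (rule the_equality)
  show "\<exists>C' B'. represents n R C' B' \<and> block_complexification C B = block_complexification C' B'"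
    using assms by blast
next
  fix M assume "\<exists>C B. represents n R C B \<and> M = block_complexification C B"
  then obtain C' B' where "represents n R C' B'" "M = block_complexification C' B'" by blast
  thus "M = block_complexification C B" using represents_unique[OF assms] by metis
qed

lemma represents_shift:
  assumes "represents n R C B"
  shows "represents n (\<lambda>x. R x - z \<cdot>\<^sub>v x) (C - z \<cdot>\<^sub>m 1\<^sub>m n) B"
proof -
  have C: "C \<in> carrier_mat n n" and B: "B \<in> carrier_mat n n"
    and R: "\<And>x. x \<in> carrier_vec n \<Longrightarrow> R x = C *\<^sub>v x + B *\<^sub>v conjugate x"
    using assms unfolding represents_def by auto
  have "R x - z \<cdot>\<^sub>v x = (C - z \<cdot>\<^sub>m 1\<^sub>m n) *\<^sub>v x + B *\<^sub>v conjugate x" if x: "x \<in> carrier_vec n" for x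
  proof -
    have "(C - z \<cdot>\<^sub>m 1\<^sub>m n) *\<^sub>v x = C *\<^sub>v x - z \<cdot>\<^sub>v x"
      using C x by (subst minus_mult_distrib_mat_vec[of _ n n]) auto
    thus ?thesis using R[OF x] C B x by (intro eq_vecI) auto
  qed
  thus ?thesis using C B unfolding represents_def by (auto intro!: minus_carrier_mat)
qed

lemma rl_charpoly_eq:
  assumes "represents n R C B"
  shows "rl_charpoly n R z = Determinant.det (block_complexification (C - z \<cdot>\<^sub>m 1\<^sub>m n) B)"
  unfolding rl_charpoly_def complexification_eq[OF represents_shift[OF assms]] ..

lemma block_complexification_carrier:
  "C \<in> carrier_mat n n \<Longrightarrow> B \<in> carrier_mat n n \<Longrightarrow>
    block_complexification C B \<in> carrier_mat (n + n) (n + n)"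
  unfolding block_complexification_def by auto

interpretation cnj_hom: comm_ring_hom cnj
  by unfold_locales auto

lemma det_block_complexification_real:
  assumes C: "C \<in> carrier_mat n n" and B: "B \<in> carrier_mat n n"
  shows "Determinant.det (block_complexification C B) \<in> \<real>"
proof -
  let ?M = "block_complexification C B"
  note car = block_complexification_carrier[OF C B]
  let ?M1 = "mat (n + n) (n + n) (\<lambda>(i,j). ?M $$ ((if i < n then i + n else i - n), j))"
  have "Determinant.det ?M = (-1)^(n * n) * Determinant.det ?M1"
    by (rule det_swap_rows[OF car])
  also have "Determinant.det ?M1 = (-1)^(n * n) * Determinant.det (mat (n + n) (n + n)
      (\<lambda>(i,j). ?M1 $$ (i, (if j < n then j + n else j - n))))"
    by (rule det_swap_cols) auto
  also have "mat (n + n) (n + n) (\<lambda>(i,j). ?M1 $$ (i, (if j < n then j + n else j - n)))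
      = map_mat cnj ?M"
    using C B by (intro eq_matI) (auto simp: block_complexification_def)
  also have "Determinant.det (map_mat cnj ?M) = cnj (Determinant.det ?M)" by simp
  finally have "Determinant.det ?M = cnj (Determinant.det ?M)"
    by (simp add: power_add[symmetric] mult.assoc[symmetric])
  thus ?thesis by (simp add: Reals_cnj_iff)
qed

lemma rl_charpoly_real:
  assumes "real_linear_op n R"
  shows "rl_charpoly n R z \<in> \<real>"
proof -
  obtain C B where CB: "represents n R C B" using represents_exists[OF assms] by blast
  from represents_shift[OF this, of z] show ?thesis
    unfolding rl_charpoly_eq[OF CB]
    by (intro det_block_complexification_real) (auto simp: represents_def)
qed

lemma numerical_function_eq:
  assumes "real_linear_op n R"
  shows "complex_of_real (numerical_function n R z) =
    rl_charpoly n R z / complex_of_real (\<Sum>j\<le>n. cmod z ^ (2 * j))"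
  using rl_charpoly_real[OF assms, of z]
  by (simp only: numerical_function_def of_real_divide of_real_Re)


section \<open>The coefficient matrix\<close>

definition bipoly :: "nat \<Rightarrow> nat \<Rightarrow> (complex \<Rightarrow> complex) \<Rightarrow> bool" where
  "bipoly a b f \<longleftrightarrow> (\<exists>h. \<forall>z. f z = (\<Sum>i\<le>a. \<Sum>j\<le>b. h i j * z ^ j * cnj z ^ i))"

lemma bipoly_const: "bipoly 0 0 (\<lambda>_. c)"
  unfolding bipoly_def by (rule exI[of _ "\<lambda>_ _. c"]) simp

lemma bipoly_add:
  assumes "bipoly a b f" "bipoly a b g"
  shows "bipoly a b (\<lambda>z. f z + g z)"
proof -
  obtain h k where hk: "\<And>z. f z = (\<Sum>i\<le>a. \<Sum>j\<le>b. h i j * z ^ j * cnj z ^ i)"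
    "\<And>z. g z = (\<Sum>i\<le>a. \<Sum>j\<le>b. k i j * z ^ j * cnj z ^ i)"
    using assms unfolding bipoly_def by blast
  show ?thesis unfolding bipoly_def
    by (rule exI[of _ "\<lambda>i j. h i j + k i j"]) (simp add: hk sum.distrib ring_distribs)
qed

lemma bipoly_cmult:
  assumes "bipoly a b f"
  shows "bipoly a b (\<lambda>z. c * f z)"
proof -
  obtain h where h: "\<And>z. f z = (\<Sum>i\<le>a. \<Sum>j\<le>b. h i j * z ^ j * cnj z ^ i)"
    using assms unfolding bipoly_def by blast
  show ?thesis unfolding bipoly_def
    by (rule exI[of _ "\<lambda>i j. c * h i j"]) (simp add: h sum_distrib_left mult_ac)
qed

lemma bipoly_sum:
  assumes "finite S" "\<And>s. s \<in> S \<Longrightarrow> bipoly a b (f s)"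
  shows "bipoly a b (\<lambda>z. \<Sum>s\<in>S. f s z)"
  using assms
proof (induction S rule: finite_induct)
  case empty
  show ?case unfolding bipoly_def by (rule exI[of _ "\<lambda>_ _. 0"]) simp
next
  case (insert x F)
  thus ?case by (auto intro: bipoly_add)
qed

lemma bipoly_mult_z:
  assumes "bipoly a b f"
  shows "bipoly a (Suc b) (\<lambda>z. (\<alpha> + \<beta> * z) * f z)"
proof -
  obtain h where h: "\<And>z. f z = (\<Sum>i\<le>a. \<Sum>j\<le>b. h i j * z ^ j * cnj z ^ i)"
    using assms unfolding bipoly_def by blast
  define k where "k = (\<lambda>i j. (if j \<le> b then \<alpha> * h i j else 0) + (case j of 0 \<Rightarrow> 0 | Suc j' \<Rightarrow> \<beta> * h i j'))"
  have "(\<Sum>j\<le>Suc b. k i j * z ^ j * w) = (\<alpha> + \<beta> * z) * (\<Sum>j\<le>b. h i j * z ^ j * w)" for i z w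
  proof -
    have "(\<Sum>j\<le>Suc b. k i j * z ^ j * w) =
        (\<Sum>j\<le>Suc b. (if j \<le> b then \<alpha> * h i j else 0) * z ^ j * w)
        + (\<Sum>j\<le>Suc b. (case j of 0 \<Rightarrow> 0 | Suc j' \<Rightarrow> \<beta> * h i j') * z ^ j * w)"
      by (simp only: k_def ring_distribs sum.distrib)
    also have "(\<Sum>j\<le>Suc b. (if j \<le> b then \<alpha> * h i j else 0) * z ^ j * w) = (\<Sum>j\<le>b. \<alpha> * h i j * z ^ j * w)"
      by simp
    also have "(\<Sum>j\<le>Suc b. (case j of 0 \<Rightarrow> 0 | Suc j' \<Rightarrow> \<beta> * h i j') * z ^ j * w) = (\<Sum>j\<le>b. \<beta> * h i j * z ^ Suc j * w)"
      by (subst sum.atMost_Suc_shift) simp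
    finally show ?thesis
      by (simp add: ring_distribs sum_distrib_left mult_ac)
  qed
  thus ?thesis unfolding bipoly_def
    by (intro exI[of _ k]) (simp add: h sum_distrib_left del: sum.atMost_Suc)
qed

lemma bipoly_cnj:
  assumes "bipoly a b f"
  shows "bipoly b a (\<lambda>z. f (cnj z))"
proof -
  obtain h where h: "\<And>z. f z = (\<Sum>i\<le>a. \<Sum>j\<le>b. h i j * z ^ j * cnj z ^ i)"
    using assms unfolding bipoly_def by blast
  show ?thesis unfolding bipoly_def
    by (rule exI[of _ "\<lambda>i j. h j i"]) (simp add: h, subst sum.swap, simp add: mult_ac)
qed

lemma bipoly_mult_cnj:
  assumes "bipoly a b f"
  shows "bipoly (Suc a) b (\<lambda>z. (\<alpha> + \<beta> * cnj z) * f z)"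
  using bipoly_cnj[OF bipoly_mult_z[OF bipoly_cnj[OF assms]], of \<alpha> \<beta>] by simp

lemma bipoly_rl_charpoly:
  assumes "real_linear_op n R"
  shows "bipoly n n (rl_charpoly n R)"
proof -
  obtain C B where CB: "represents n R C B" using represents_exists[OF assms] by blast
  hence C: "C \<in> carrier_mat n n" and B: "B \<in> carrier_mat n n" by (auto simp: represents_def)
  define M where "M z = block_complexification (C - z \<cdot>\<^sub>m 1\<^sub>m n) B" for z
  have C': "C - z \<cdot>\<^sub>m 1\<^sub>m n \<in> carrier_mat n n" for z using C by (auto intro!: minus_carrier_mat)
  have car: "M z \<in> carrier_mat (n + n) (n + n)" for z
    unfolding M_def using block_complexification_carrier[OF C' B] .
  have e1: "\<exists>\<alpha> \<beta>. \<forall>z. M z $$ (i, j) = \<alpha> + \<beta> * z" if "i < n" "j < n + n" for i j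
  proof (cases "j < n")
    case True
    thus ?thesis using that C B
      by (intro exI[of _ "C $$ (i,j)"] exI[of _ "if i = j then -1 else 0"])
        (auto simp: M_def block_complexification_def)
  next
    case False
    thus ?thesis using that C B
      by (intro exI[of _ "B $$ (i,j-n)"] exI[of _ 0]) (auto simp: M_def block_complexification_def)
  qed
  have e2: "\<exists>\<alpha> \<beta>. \<forall>z. M z $$ (n + i, j) = \<alpha> + \<beta> * cnj z" if "i < n" "j < n + n" for i j
  proof (cases "j < n")
    case False
    thus ?thesis using that C B
      by (intro exI[of _ "cnj (C $$ (i,j-n))"] exI[of _ "if i = j-n then -1 else 0"])
        (auto simp: M_def block_complexification_def)
  next
    case True
    thus ?thesis using that C B
      by (intro exI[of _ "cnj (B $$ (i,j))"] exI[of _ 0]) (auto simp: M_def block_complexification_def)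
  qed
  have "bipoly n n (\<lambda>z. \<Prod>i=0..<n+n. M z $$ (i, p i))" if p: "p permutes {0..<n+n}" for p
  proof -
    have pin: "p i < n + n" if "i < n + n" for i
      using permutes_in_image[OF p, of i] that by simp
    have 1: "bipoly 0 m (\<lambda>z. \<Prod>i<m. M z $$ (i, p i))" if "m \<le> n" for m
      using that
    proof (induction m)
      case 0
      show ?case using bipoly_const by simp
    next
      case (Suc m)
      obtain \<alpha> \<beta> where "\<And>z. M z $$ (m, p m) = \<alpha> + \<beta> * z"
        using e1[of m "p m"] pin[of m] Suc.prems by auto
      thus ?case using bipoly_mult_z[OF Suc.IH, of \<alpha> \<beta>] Suc.prems by (simp add: mult.commute)
    qed
    have 2: "bipoly m n (\<lambda>z. \<Prod>i<n+m. M z $$ (i, p i))" if "m \<le> n" for m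
      using that
    proof (induction m)
      case 0
      show ?case using 1[of n] by simp
    next
      case (Suc m)
      obtain \<alpha> \<beta> where "\<And>z. M z $$ (n + m, p (n + m)) = \<alpha> + \<beta> * cnj z"
        using e2[of m "p (n + m)"] pin[of "n + m"] Suc.prems by auto
      thus ?case using bipoly_mult_cnj[OF Suc.IH, of \<alpha> \<beta>] Suc.prems by (simp add: mult.commute)
    qed
    show ?thesis using 2[of n] by (simp add: lessThan_atLeast0)
  qed
  hence "bipoly n n (\<lambda>z. \<Sum>p\<in>{p. p permutes {0..<n+n}}. signof p * (\<Prod>i=0..<n+n. M z $$ (i, p i)))"
    by (intro bipoly_sum bipoly_cmult) (auto intro: finite_permutations)
  moreover have "rl_charpoly n R = (\<lambda>z. \<Sum>p\<in>{p. p permutes {0..<n+n}}. signof p * (\<Prod>i=0..<n+n. M z $$ (i, p i)))"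
    using rl_charpoly_eq[OF CB] det_def'[OF car] by (auto simp: M_def)
  ultimately show ?thesis by simp
qed

lemma bipoly_coeff_zero:
  fixes h :: "nat \<Rightarrow> nat \<Rightarrow> complex"
  assumes zero: "\<And>z. (\<Sum>i\<le>n. \<Sum>j\<le>n. h i j * z ^ j * cnj z ^ i) = 0"
    and ij: "i \<le> n" "j \<le> n"
  shows "h i j = 0"
proof -
  text \<open>On a circle of radius \<open>r\<close> we have \<open>cnj z = r\<^sup>2 / z\<close>, which gives a polynomial in \<open>z\<close>.\<close>
  define P where "P r = (\<Sum>i\<le>n. \<Sum>j\<le>n. monom (h i j * complex_of_real r ^ (2 * i)) (n + j - i))" for r
  have P0: "P r = 0" if r: "r > 0" for r
  proof (rule ccontr)
    assume "P r \<noteq> 0"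
    hence "finite {z. poly (P r) z = 0}" by (rule poly_roots_finite)
    moreover have "(\<lambda>t. rcis r t) ` {0..<1} \<subseteq> {z. poly (P r) z = 0}"
    proof clarify
      fix t :: real
      define z where "z = rcis r t"
      have zc: "z * cnj z = (complex_of_real r)\<^sup>2"
        using r complex_norm_square[of z] by (simp add: z_def)
      have "poly (P r) z = (\<Sum>i\<le>n. \<Sum>j\<le>n. h i j * complex_of_real r ^ (2 * i) * z ^ (n + j - i))"
        by (simp add: P_def poly_sum poly_monom)
      also have "\<dots> = (\<Sum>i\<le>n. \<Sum>j\<le>n. z ^ n * (h i j * z ^ j * cnj z ^ i))"
      proof (intro sum.cong refl)
        fix i j assume "i \<in> {..n}"
        hence "n + j = (n + j - i) + i" by simp
        hence "z ^ n * z ^ j = z ^ (n + j - i) * z ^ i" by (metis power_add)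
        hence "z ^ n * (h i j * z ^ j * cnj z ^ i) = h i j * z ^ (n + j - i) * (z * cnj z) ^ i"
          by (simp add: power_mult_distrib mult_ac)
        thus "h i j * complex_of_real r ^ (2 * i) * z ^ (n + j - i) = z ^ n * (h i j * z ^ j * cnj z ^ i)"
          unfolding zc power_mult[symmetric] by (simp only: mult_ac)
      qed
      also have "\<dots> = z ^ n * (\<Sum>i\<le>n. \<Sum>j\<le>n. h i j * z ^ j * cnj z ^ i)"
        by (simp add: sum_distrib_left)
      finally show "poly (P r) (rcis r t) = 0" using zero by (simp add: z_def)
    qed
    moreover have "inj_on (\<lambda>t. rcis r t) {0..<1::real}"
    proof (rule inj_onI)
      fix s t :: real assume st: "s \<in> {0..<1}" "t \<in> {0..<1}" "rcis r s = rcis r t"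
      hence "cos s = cos t" using r by (auto simp: complex_eq_iff)
      moreover have "s \<le> pi" "t \<le> pi" using st pi_ge_two by auto
      ultimately show "s = t" using st cos_inj_pi[of s t] by auto
    qed
    hence "infinite ((\<lambda>t. rcis r t) ` {0..<1::real})"
      by (simp add: finite_image_iff infinite_Ico)
    ultimately show False using finite_subset by blast
  qed
  define Q where "Q = (\<Sum>i'\<le>n. monom (if i' + j \<ge> i \<and> i' + j - i \<le> n
      then h i' (i' + j - i) else 0) (2 * i'))"
  have "poly Q (complex_of_real r) = 0" if r: "r > 0" for r
  proof -
    have "0 = coeff (P r) (n + j - i)" using P0[OF r] by simp
    also have "\<dots> = (\<Sum>i'\<le>n. \<Sum>j'\<le>n. if j' = i' + j - i \<and> i' + j \<ge> i
         then h i' j' * complex_of_real r ^ (2 * i') else 0)"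
      unfolding P_def coeff_sum using ij
      by (intro sum.cong refl) auto
    also have "\<dots> = poly Q (complex_of_real r)"
      unfolding Q_def poly_sum poly_monom using ij
      by (intro sum.cong refl) (auto simp: if_distrib if_distribR sum.delta cong: if_cong)
    finally show ?thesis by simp
  qed
  hence "complex_of_real ` {0<..} \<subseteq> {z. poly Q z = 0}" by auto
  moreover have "infinite (complex_of_real ` {0<..})"
    by (simp add: finite_image_iff inj_on_def infinite_Ioi)
  ultimately have "Q = 0" using poly_roots_finite[of Q] finite_subset by blast
  hence "0 = coeff Q (2 * i)" by simp
  also have "\<dots> = (\<Sum>i'\<le>n. if i' = i then h i j else 0)"
    unfolding Q_def coeff_sum using ij by (intro sum.cong refl) auto
  also have "\<dots> = h i j" using ij by simp
  finally show ?thesis by simp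
qed

lemma is_coeff_matrix_unique:
  assumes "is_coeff_matrix n p H" "is_coeff_matrix n p H'"
  shows "H = H'"
proof (rule eq_matI)
  have car: "H \<in> carrier_mat (n+1) (n+1)" "H' \<in> carrier_mat (n+1) (n+1)"
    using assms by (auto simp: is_coeff_matrix_def)
  thus "dim_row H = dim_row H'" "dim_col H = dim_col H'" by auto
  fix i j assume "i < dim_row H'" "j < dim_col H'"
  hence ij: "i \<le> n" "j \<le> n" using car by auto
  have "H $$ (i, j) - H' $$ (i, j) = 0"
  proof (rule bipoly_coeff_zero[OF _ ij, where h = "\<lambda>i j. H $$ (i, j) - H' $$ (i, j)"])
    fix z
    have "(\<Sum>i\<le>n. \<Sum>j\<le>n. H $$ (i, j) * z ^ j * cnj z ^ i) = (\<Sum>i\<le>n. \<Sum>j\<le>n. H' $$ (i, j) * z ^ j * cnj z ^ i)"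
      using assms unfolding is_coeff_matrix_def by metis
    thus "(\<Sum>i\<le>n. \<Sum>j\<le>n. (H $$ (i, j) - H' $$ (i, j)) * z ^ j * cnj z ^ i) = 0"
      by (simp add: left_diff_distrib sum_subtractf)
  qed
  thus "H $$ (i, j) = H' $$ (i, j)" by simp
qed

lemma coeff_matrix_ex1:
  assumes "real_linear_op n R"
  shows "\<exists>!H. is_coeff_matrix n (rl_charpoly n R) H"
proof -
  obtain h where "\<And>z. rl_charpoly n R z = (\<Sum>i\<le>n. \<Sum>j\<le>n. h i j * z ^ j * cnj z ^ i)"
    using bipoly_rl_charpoly[OF assms] unfolding bipoly_def by blast
  hence "is_coeff_matrix n (rl_charpoly n R) (mat (n+1) (n+1) (\<lambda>(i,j). h i j))"
    unfolding is_coeff_matrix_def by simp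
  thus ?thesis using is_coeff_matrix_unique by blast
qed

lemma coeff_matrix_is_coeff_matrix:
  assumes "real_linear_op n R"
  shows "is_coeff_matrix n (rl_charpoly n R) (coeff_matrix n R)"
  unfolding coeff_matrix_def by (rule theI') (rule coeff_matrix_ex1[OF assms])

end

theory Submission
  imports Defs
begin

text \<open>
  Let \<open>v = (1, \<lambda>, \<dots>, \<lambda>\<^sup>n)\<close>. The coefficient matrix \<open>H\<close> satisfies \<open>p(\<lambda>, cnj \<lambda>) = v\<^sup>* H v\<close>, and
  \<open>\<Sum>\<^sub>j \<bar>\<lambda>\<bar>\<^sup>2\<^sup>j = \<parallel>v\<parallel>\<^sup>2\<close>, so \<open>F(\<lambda>)\<close> is the Rayleigh quotient of \<open>H\<close> at \<open>v\<close>. If \<open>H = U\<^sup>* D U\<close> with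
  \<open>U\<close> unitary, then \<open>v\<^sup>* H v = \<Sum>\<^sub>i d\<^sub>i \<bar>(U v)\<^sub>i\<bar>\<^sup>2\<close> (\<open>diagonalized_quadratic_form\<close>) and
  \<open>\<parallel>v\<parallel>\<^sup>2 = \<Sum>\<^sub>i \<bar>(U v)\<^sub>i\<bar>\<^sup>2\<close> (\<open>unitary_mat_isometry\<close>). Since \<open>(U v)\<^sub>i = q\<^sub>i(\<lambda>)\<close> for
  the polynomial \<open>q\<^sub>i\<close> whose coefficients form the \<open>i\<close>th row of \<open>U\<close>, this is the representation
  of \<open>F(\<lambda>)\<close> as a weighted average of the \<open>d\<^sub>i\<close>, from which continuity and the value at \<open>0\<close> can be
  read off.

  The same two identities identify \<open>W(H)\<close> with the set of all weighted averages of the \<open>d\<^sub>i\<close>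
  (\<open>field_of_values_unitary_diag\<close>), that is, with the interval from the least to the greatest \<open>d\<^sub>i\<close>
  (\<open>weighted_averages_eq_interval\<close>). As the \<open>d\<^sub>i\<close> are exactly the eigenvalues of \<open>H\<close>, this is
  \<open>[\<lambda>\<^sub>m\<^sub>i\<^sub>n(H), \<lambda>\<^sub>m\<^sub>a\<^sub>x(H)]\<close>.

  The limit of \<open>F\<close> at infinity is computed twice. The weighted average tends to
  \<open>\<Sum>\<^sub>i d\<^sub>i \<bar>u\<^sub>i\<^sub>n\<bar>\<^sup>2\<close>, since \<open>q\<^sub>i(\<lambda>) / \<lambda>\<^sup>n\<close> tends to \<open>u\<^sub>i\<^sub>n\<close>. On the other hand, the determinant that defines
  \<open>p\<close> shows that \<open>p(\<lambda>, cnj \<lambda>)\<close> is asymptotic to \<open>\<bar>\<lambda>\<bar>\<^sup>2\<^sup>n\<close> (\<open>rl_charpoly_leading\<close>), so the limit is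
  \<open>1\<close>. The intermediate value theorem then yields all values between \<open>F(0) = det R\<^sup>C\<close> and \<open>1\<close>.
\<close>


section \<open>Quadratic forms diagonalized by a unitary matrix\<close>

lemma mat_adjoint_carrier:
  "A \<in> carrier_mat m k \<Longrightarrow> mat_adjoint A \<in> carrier_mat k m"
  by (auto simp: mat_adjoint_def)

lemma mat_adjoint_index:
  fixes A :: "complex mat"
  assumes "i < dim_col A" "j < dim_row A"
  shows "mat_adjoint A $$ (i, j) = cnj (A $$ (j, i))"
  using assms by (simp add: mat_adjoint_def mat_of_rows_index)

lemma cnj_sum_mult_sum:
  fixes a b :: "nat \<Rightarrow> complex"
  shows "cnj (\<Sum>j<m. a j * b j) * (\<Sum>j<m. a j * b j) =
    (\<Sum>i<m. \<Sum>j<m. cnj (b i) * (cnj (a i) * a j) * b j)"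
  unfolding cnj_sum sum_product by (simp add: mult_ac)

lemma scalar_prod_mult_mat_vec:
  fixes M :: "complex mat"
  assumes "M \<in> carrier_mat m m" "x \<in> carrier_vec m" "y \<in> carrier_vec m"
  shows "y \<bullet> (M *\<^sub>v x) = (\<Sum>i<m. \<Sum>j<m. y $ i * M $$ (i, j) * x $ j)"
proof -
  have "y \<bullet> (M *\<^sub>v x) = (\<Sum>i<m. y $ i * (M *\<^sub>v x) $ i)"
    using assms(1) by (simp add: scalar_prod_def lessThan_atLeast0)
  also have "\<dots> = (\<Sum>i<m. y $ i * (\<Sum>j<m. M $$ (i, j) * x $ j))"
    by (intro sum.cong refl) (simp only: mult_mat_vec_index[OF assms(1,2)] lessThan_iff)
  finally show ?thesis by (simp add: sum_distrib_left mult_ac)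
qed

lemma adjoint_diag_mult_index:
  fixes A :: "complex mat"
  assumes A: "A \<in> carrier_mat m m" and ij: "i < m" "j < m"
  shows "(mat_adjoint A * mat_diag m f * A) $$ (i, j) =
    (\<Sum>k<m. cnj (A $$ (k, i)) * f k * A $$ (k, j))"
proof -
  have "(mat_adjoint A * mat_diag m f * A) $$ (i, j) =
      (\<Sum>k<m. mat_adjoint A $$ (i, k) * f k * A $$ (k, j))"
    unfolding mat_diag_mult_right[OF mat_adjoint_carrier[OF A]]
    using A ij by (auto simp: scalar_prod_def lessThan_atLeast0 intro!: sum.cong)
  also have "\<dots> = (\<Sum>k<m. cnj (A $$ (k, i)) * f k * A $$ (k, j))"
    using A ij by (intro sum.cong refl) (simp add: mat_adjoint_index)
  finally show ?thesis .
qed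

text \<open>This is \<open>x\<^sup>* A\<^sup>* D A x = (A x)\<^sup>* D (A x)\<close>. The case \<open>D = 1\<close> with
  \<open>A\<close> unitary says that unitary matrices preserve the Euclidean norm.\<close>

lemma diagonalized_quadratic_form:
  fixes A :: "complex mat" and d :: "nat \<Rightarrow> real"
  assumes A: "A \<in> carrier_mat m m" and x: "x \<in> carrier_vec m"
  shows "conjugate x \<bullet> ((mat_adjoint A * mat_diag m (\<lambda>i. complex_of_real (d i)) * A) *\<^sub>v x) =
    complex_of_real (\<Sum>k<m. d k * (cmod ((A *\<^sub>v x) $ k))\<^sup>2)"
proof -
  let ?M = "mat_adjoint A * mat_diag m (\<lambda>i. complex_of_real (d i)) * A"
  have M: "?M \<in> carrier_mat m m" using A mat_adjoint_carrier[OF A] by (auto intro!: mult_carrier_mat)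
  have "conjugate x \<bullet> (?M *\<^sub>v x) =
      (\<Sum>i<m. \<Sum>j<m. cnj (x $ i) * ?M $$ (i, j) * x $ j)"
    using x by (subst scalar_prod_mult_mat_vec[OF M x]) (auto intro!: sum.cong)
  also have "\<dots> = (\<Sum>i<m. \<Sum>j<m. \<Sum>k<m. d k * (cnj (x $ i) * (cnj (A $$ (k, i)) * A $$ (k, j)) * x $ j))"
    by (intro sum.cong refl)
      (simp only: adjoint_diag_mult_index[OF A] lessThan_iff sum_distrib_left sum_distrib_right mult_ac)
  also have "\<dots> = (\<Sum>k<m. \<Sum>i<m. \<Sum>j<m. d k * (cnj (x $ i) * (cnj (A $$ (k, i)) * A $$ (k, j)) * x $ j))"
    by (rule trans[OF sum.cong[OF refl sum.swap] sum.swap])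
  also have "\<dots> = (\<Sum>k<m. d k * (cnj ((A *\<^sub>v x) $ k) * (A *\<^sub>v x) $ k))"
    by (intro sum.cong refl)
      (simp only: mult_mat_vec_index[OF A x] lessThan_iff cnj_sum_mult_sum, simp only: sum_distrib_left)
  also have "\<dots> = complex_of_real (\<Sum>k<m. d k * (cmod ((A *\<^sub>v x) $ k))\<^sup>2)"
    by (simp only: of_real_sum of_real_mult complex_norm_square mult.commute[of "cnj _"])
  finally show ?thesis .
qed

lemma unitary_matD:
  assumes "unitary_mat U" "U \<in> carrier_mat m m"
  shows "U * mat_adjoint U = 1\<^sub>m m" "mat_adjoint U * U = 1\<^sub>m m"
  using assms mat_adjoint_carrier[OF assms(2)] by (auto simp: unitary_mat_def inverts_mat_def)

lemma unitary_mat_isometry: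
  assumes U: "U \<in> carrier_mat m m" "unitary_mat U" and x: "x \<in> carrier_vec m"
  shows "(\<Sum>k<m. (cmod ((U *\<^sub>v x) $ k))\<^sup>2) = (\<Sum>k<m. (cmod (x $ k))\<^sup>2)"
proof -
  note Us = mat_adjoint_carrier[OF U(1)]
  have "mat_adjoint U * mat_diag m (\<lambda>i. complex_of_real 1) * U = 1\<^sub>m m"
    using Us unitary_matD[OF U(2,1)] by simp
  from diagonalized_quadratic_form[OF U(1) x, of "\<lambda>_. 1", unfolded this]
  have "complex_of_real (\<Sum>k<m. (cmod ((U *\<^sub>v x) $ k))\<^sup>2) = conjugate x \<bullet> x"
    using x by simp
  also have "\<dots> = complex_of_real (\<Sum>k<m. (cmod (x $ k))\<^sup>2)"
    using x by (simp add: scalar_prod_def lessThan_atLeast0 complex_norm_square[symmetric] mult.commute[of "cnj _"]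
      del: of_real_power)
  finally show ?thesis by (simp only: of_real_eq_iff)
qed


section \<open>Eigenvalues and field of values of a diagonalized matrix\<close>

text \<open>Similarity preserves the characteristic polynomial, and the roots of that of a diagonal
  matrix are its diagonal entries.\<close>

lemma eigenvalue_unitary_diag_iff:
  assumes U: "U \<in> carrier_mat m m" "unitary_mat U"
  shows "eigenvalue (mat_adjoint U * mat_diag m f * U) k \<longleftrightarrow> (\<exists>i<m. k = f i)"
proof -
  let ?H = "mat_adjoint U * mat_diag m f * U"
  note Us = mat_adjoint_carrier[OF U(1)]
  have H: "?H \<in> carrier_mat m m" using U(1) Us by (auto intro!: mult_carrier_mat)
  have "similar_mat ?H (mat_diag m f)"
    by (rule similar_matI[of _ _ "mat_adjoint U" U m])
      (use H U(1) Us unitary_matD[OF U(2,1)] in auto)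
  hence "char_poly ?H = char_poly (mat_diag m f)" by (rule char_poly_similar)
  also have "\<dots> = (\<Prod>a\<leftarrow>diag_mat (mat_diag m f). [:- a, 1:])"
    by (rule char_poly_upper_triangular) (auto simp: mat_diag_def)
  also have "diag_mat (mat_diag m f) = map f [0..<m]"
    by (auto simp: diag_mat_def mat_diag_def)
  finally have "char_poly ?H = (\<Prod>a\<leftarrow>map f [0..<m]. [:- a, 1:])" .
  hence "eigenvalue ?H k \<longleftrightarrow> k \<in> set (map f [0..<m])"
    unfolding eigenvalue_root_char_poly[OF H]
    by (simp add: poly_prod_list prod_list_zero_iff image_iff o_def) 
  thus ?thesis by auto
qed

text \<open>The substitution \<open>y = U x\<close> turns the quadratic form into a weighted average with weights
  \<open>\<bar>y\<^sub>i\<bar>\<^sup>2\<close>, and every system of weights arises in this way from \<open>y\<^sub>i = sqrt w\<^sub>i\<close>.\<close>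

lemma field_of_values_unitary_diag:
  fixes d :: "nat \<Rightarrow> real"
  assumes U: "U \<in> carrier_mat m m" "unitary_mat U"
  shows "field_of_values (mat_adjoint U * mat_diag m (\<lambda>i. complex_of_real (d i)) * U) =
    complex_of_real ` {\<Sum>i<m. d i * w i | w. (\<forall>i<m. w i \<ge> 0) \<and> (\<Sum>i<m. w i) = 1}"
    (is "field_of_values ?H = complex_of_real ` ?W")
proof
  note Us = mat_adjoint_carrier[OF U(1)]
  have H: "dim_row ?H = m" using Us by simp
  show "field_of_values ?H \<subseteq> complex_of_real ` ?W"
  proof
    fix c assume "c \<in> field_of_values ?H"
    then obtain x where x: "x \<in> carrier_vec m" "euclid_norm x = 1"
      and c: "c = conjugate x \<bullet> (?H *\<^sub>v x)"
      unfolding field_of_values_def H by blast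
    have "(\<Sum>i<m. (cmod (x $ i))\<^sup>2) = 1" using x by (simp add: euclid_norm_def)
    hence "(\<Sum>i<m. (cmod ((U *\<^sub>v x) $ i))\<^sup>2) = 1"
      using unitary_mat_isometry[OF U x(1)] by simp
    hence "(\<Sum>i<m. d i * (cmod ((U *\<^sub>v x) $ i))\<^sup>2) \<in> ?W"
      by (intro CollectI exI[of _ "\<lambda>i. (cmod ((U *\<^sub>v x) $ i))\<^sup>2"]) simp
    thus "c \<in> complex_of_real ` ?W"
      unfolding c diagonalized_quadratic_form[OF U(1) x(1)] by (rule imageI)
  qed
  show "complex_of_real ` ?W \<subseteq> field_of_values ?H"
  proof (rule image_subsetI)
    fix t assume "t \<in> ?W"
    then obtain w where w: "\<forall>i<m. w i \<ge> 0" "(\<Sum>i<m. w i) = 1" and t: "t = (\<Sum>i<m. d i * w i)"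
      by blast
    define y where "y = vec m (\<lambda>i. complex_of_real (sqrt (w i)))"
    define x where "x = mat_adjoint U *\<^sub>v y"
    have y: "y \<in> carrier_vec m" by (simp add: y_def)
    have x: "x \<in> carrier_vec m" using Us y by (simp add: x_def)
    have "U *\<^sub>v x = (U * mat_adjoint U) *\<^sub>v y"
      unfolding x_def by (rule assoc_mult_mat_vec[OF U(1) Us y, symmetric])
    hence Ux: "U *\<^sub>v x = y" using y unitary_matD[OF U(2,1)] by simp
    have yw: "(cmod (y $ i))\<^sup>2 = w i" if "i < m" for i
      using w that by (simp add: y_def)
    have "(\<Sum>i<m. (cmod (x $ i))\<^sup>2) = 1"
      using unitary_mat_isometry[OF U x] w(2) yw by (simp add: Ux)
    hence "euclid_norm x = 1" using x by (simp add: euclid_norm_def)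
    moreover have "complex_of_real t = conjugate x \<bullet> (?H *\<^sub>v x)"
      unfolding diagonalized_quadratic_form[OF U(1) x] Ux t using yw by simp
    ultimately show "complex_of_real t \<in> field_of_values ?H"
      unfolding field_of_values_def H using x by blast
  qed
qed

text \<open>Every point between the least and the greatest \<open>d\<^sub>i\<close> is already an average of these two, so
  weights on at most two indices suffice.\<close>

lemma weighted_averages_eq_interval:
  fixes d :: "nat \<Rightarrow> real"
  assumes m: "m > 0"
  shows "{\<Sum>i<m. d i * w i | w. (\<forall>i<m. w i \<ge> 0) \<and> (\<Sum>i<m. w i) = 1} =
    {Min (d ` {..<m})..Max (d ` {..<m})}" (is "?W = {?a..?b}")
proof
  have fin: "finite (d ` {..<m})" "d ` {..<m} \<noteq> {}" using m by auto
  show "?W \<subseteq> {?a..?b}"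
  proof clarify
    fix w :: "nat \<Rightarrow> real" assume w: "\<forall>i<m. w i \<ge> 0" "(\<Sum>i<m. w i) = 1"
    have "(\<Sum>i<m. ?a * w i) \<le> (\<Sum>i<m. d i * w i)" "(\<Sum>i<m. d i * w i) \<le> (\<Sum>i<m. ?b * w i)"
      using w(1) fin by (auto intro!: sum_mono mult_right_mono Min_le Max_ge)
    thus "(\<Sum>i<m. d i * w i) \<in> {?a..?b}"
      using w(2) by (simp add: sum_distrib_left[symmetric])
  qed
  show "{?a..?b} \<subseteq> ?W"
  proof
    fix t assume t: "t \<in> {?a..?b}"
    obtain i k where ik: "i < m" "k < m" "d i = ?a" "d k = ?b"
      using Min_in[OF fin] Max_in[OF fin] by auto
    have "\<exists>s. 0 \<le> s \<and> s \<le> 1 \<and> t = (1 - s) * a + s * b" if "a \<le> t" "t \<le> b" for a b :: real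
    proof (cases "a = b")
      case True
      thus ?thesis using that by (intro exI[of _ 0]) simp
    next
      case False
      define s where "s = (t - a) / (b - a)"
      have "0 \<le> s" "s \<le> 1" "s * (b - a) = t - a"
        using that False by (simp_all add: s_def field_simps)
      thus ?thesis by (intro exI[of _ s]) (simp add: algebra_simps)
    qed
    then obtain s where s: "0 \<le> s" "s \<le> 1" "t = (1 - s) * ?a + s * ?b"
      using t by (meson atLeastAtMost_iff)
    \<comment> \<open>A sum of two point masses, so that \<open>i = k\<close> needs no separate treatment.\<close>
    define w where "w l = (1 - s) * of_bool (l = i) + s * of_bool (l = k)" for l
    have sum_w: "(\<Sum>l<m. g l * w l) = (1 - s) * g i + s * g k" for g :: "nat \<Rightarrow> real"
    proof -
      have "(\<Sum>l<m. g l * w l) =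
          (\<Sum>l<m. if l = i then (1 - s) * g i else 0) + (\<Sum>l<m. if l = k then s * g k else 0)"
        unfolding sum.distrib[symmetric] by (intro sum.cong) (auto simp: w_def algebra_simps)
      thus ?thesis using ik by simp
    qed
    have "t = (\<Sum>l<m. d l * w l)" using sum_w[of d] s ik by simp
    moreover have "(\<Sum>l<m. w l) = 1" using sum_w[of "\<lambda>_. 1"] by simp
    moreover have "\<forall>l<m. w l \<ge> 0" using s by (simp add: w_def)
    ultimately show "t \<in> ?W" by blast
  qed
qed


section \<open>Behaviour at infinity\<close>

text \<open>For \<open>z \<noteq> 0\<close> the quotient is a polynomial in \<open>1 / z\<close>, whose constant term is the leading
  coefficient.\<close>

lemma tendsto_poly_over_power_at_infinity:
  fixes a :: "nat \<Rightarrow> 'a::real_normed_field"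
  shows "((\<lambda>z. (\<Sum>j\<le>n. a j * z ^ j) / z ^ n) \<longlongrightarrow> a n) at_infinity"
proof -
  have "((\<lambda>z. \<Sum>j\<le>n. a j * inverse z ^ (n - j)) \<longlongrightarrow> (\<Sum>j\<le>n. a j * 0 ^ (n - j))) at_infinity"
    by (intro tendsto_intros tendsto_inverse_0)
  moreover have "(\<Sum>j\<le>n. a j * 0 ^ (n - j)) = (\<Sum>j\<le>n. if j = n then a j else 0)"
    by (intro sum.cong) auto
  moreover have "\<forall>\<^sub>F z in at_infinity.
      (\<Sum>j\<le>n. a j * inverse z ^ (n - j)) = (\<Sum>j\<le>n. a j * z ^ j) / z ^ n"
    using eventually_not_equal_at_infinity[of 0]
  proof eventually_elim
    case (elim z)
    show ?case unfolding sum_divide_distrib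
    proof (intro sum.cong refl)
      fix j assume "j \<in> {..n}"
      hence "z ^ n = z ^ j * z ^ (n - j)" by (simp add: power_add[symmetric])
      thus "a j * inverse z ^ (n - j) = a j * z ^ j / z ^ n"
        using elim by (simp add: power_inverse field_simps)
    qed
  qed
  ultimately show ?thesis by (simp add: tendsto_cong)
qed

lemma tendsto_det:
  fixes M :: "'b \<Rightarrow> complex mat"
  assumes M: "\<And>z. M z \<in> carrier_mat m m" and L: "L \<in> carrier_mat m m"
    and lim: "\<And>i j. i < m \<Longrightarrow> j < m \<Longrightarrow> ((\<lambda>z. M z $$ (i, j)) \<longlongrightarrow> L $$ (i, j)) G"
  shows "((\<lambda>z. Determinant.det (M z)) \<longlongrightarrow> Determinant.det L) G"
  unfolding det_def'[OF M] det_def'[OF L]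
proof (intro tendsto_sum tendsto_mult tendsto_prod tendsto_const)
  fix p i assume "p \<in> {p. p permutes {0..<m}}" "i \<in> {0..<m}"
  hence "i < m" "p i < m" using permutes_in_image[of p "{0..<m}" i] by auto
  thus "((\<lambda>z. M z $$ (i, p i)) \<longlongrightarrow> L $$ (i, p i)) G" by (rule lim)
qed

lemma det_scale_rows:
  fixes M :: "'a::comm_ring_1 mat"
  assumes M: "M \<in> carrier_mat m m"
  shows "Determinant.det (mat m m (\<lambda>(i, j). s i * M $$ (i, j))) = (\<Prod>i<m. s i) * Determinant.det M"
proof -
  have "mat m m (\<lambda>(i, j). s i * M $$ (i, j)) = mat_diag m s * M"
    by (rule mat_diag_mult_left[OF M, symmetric])
  moreover have "Determinant.det (mat_diag m s) = prod_list (diag_mat (mat_diag m s))"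
    by (rule det_upper_triangular[of _ m]) (auto simp: mat_diag_def)
  moreover have "prod_list (diag_mat (mat_diag m s)) = (\<Prod>i<m. s i)"
    by (simp add: prod_list_diag_prod mat_diag_def lessThan_atLeast0)
  ultimately show ?thesis using det_mult[OF mat_diag_dim M, of s] by simp
qed

text \<open>Dividing the first \<open>n\<close> rows of the
  complexification of \<open>R - \<lambda>\<close> by \<open>-\<lambda>\<close> and the others by \<open>- cnj \<lambda>\<close> gives a matrix
  that tends to the identity, and divides the determinant by \<open>\<lambda>\<^sup>n (cnj \<lambda>)\<^sup>n = \<bar>\<lambda>\<bar>\<^sup>2\<^sup>n\<close>.\<close>

lemma rl_charpoly_leading:
  assumes R: "real_linear_op n R"
  shows "((\<lambda>z. rl_charpoly n R z / (z * cnj z) ^ n) \<longlongrightarrow> 1) at_infinity"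
proof -
  obtain C B where CB: "represents n R C B" using represents_exists[OF R] by blast
  hence C: "C \<in> carrier_mat n n" and B: "B \<in> carrier_mat n n" by (auto simp: represents_def)
  define M where "M z = block_complexification (C - z \<cdot>\<^sub>m 1\<^sub>m n) B" for z
  define s where "s z i = (if i < n then - inverse z else - inverse (cnj z))" for z :: complex and i :: nat
  let ?N = "\<lambda>z. mat (n + n) (n + n) (\<lambda>(i, j). s z i * M z $$ (i, j))"
  have C': "C - z \<cdot>\<^sub>m 1\<^sub>m n \<in> carrier_mat n n" for z using C by (auto intro!: minus_carrier_mat)
  have M: "M z \<in> carrier_mat (n + n) (n + n)" for z
    unfolding M_def using block_complexification_carrier[OF C' B] .
  have small: "((\<lambda>z. - inverse z * c) \<longlongrightarrow> 0) at_infinity" for c :: complex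
    using tendsto_mult[OF tendsto_minus[OF tendsto_inverse_0] tendsto_const[of c]] by simp
  have diag: "((\<lambda>z. - inverse z * (c - z * e)) \<longlongrightarrow> e) at_infinity" for c e :: complex
  proof (rule Lim_transform_eventually)
    show "((\<lambda>z. - inverse z * c + e) \<longlongrightarrow> e) at_infinity"
      using tendsto_add[OF small[of c] tendsto_const[of e]] by simp
    show "\<forall>\<^sub>F z in at_infinity. - inverse z * c + e = - inverse z * (c - z * e)"
      using eventually_not_equal_at_infinity[of 0] by eventually_elim (simp add: field_simps)
  qed
  have "((\<lambda>z. Determinant.det (?N z)) \<longlongrightarrow> Determinant.det (1\<^sub>m (n + n))) at_infinity"
  proof (rule tendsto_det)
    fix i j assume ij: "i < n + n" "j < n + n"
    consider "i < n" "j < n" | "i < n" "\<not> j < n" | "\<not> i < n" "j < n" | "\<not> i < n" "\<not> j < n"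
      by blast
    hence "((\<lambda>z. s z i * M z $$ (i, j)) \<longlongrightarrow> 1\<^sub>m (n + n) $$ (i, j)) at_infinity"
    proof cases
      case 1
      thus ?thesis using ij C B diag[of "C $$ (i, j)" 1] small[of "C $$ (i, j)"]
        by (cases "i = j") (simp_all add: s_def M_def block_complexification_def)
    next
      case 2
      thus ?thesis using ij C B small[of "B $$ (i, j - n)"]
        by (auto simp add: s_def M_def block_complexification_def)
    next
      case 3
      thus ?thesis using ij C B tendsto_cnj[OF small[of "B $$ (i - n, j)"]]
        by (auto simp add: s_def M_def block_complexification_def)
    next
      case 4
      hence "i - n = j - n \<longleftrightarrow> i = j" by auto
      thus ?thesis using 4 ij C B tendsto_cnj[OF diag[of "C $$ (i - n, j - n)" 1]]
          tendsto_cnj[OF small[of "C $$ (i - n, j - n)"]]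
        by (cases "i = j") (simp_all add: s_def M_def block_complexification_def)
    qed
    thus "((\<lambda>z. ?N z $$ (i, j)) \<longlongrightarrow> 1\<^sub>m (n + n) $$ (i, j)) at_infinity" using ij by simp
  qed auto
  moreover have "Determinant.det (?N z) = rl_charpoly n R z / (z * cnj z) ^ n" for z
  proof -
    have "(\<Prod>i<n + k. s z i) = (\<Prod>i<n. s z i) * (\<Prod>i<k. s z (n + i))" for k
      by (induction k) (simp_all add: mult_ac)
    hence "(\<Prod>i<n + n. s z i) = (\<Prod>i<n. s z i) * (\<Prod>i<n. s z (n + i))" .
    also have "\<dots> = inverse ((z * cnj z) ^ n)"
      by (simp add: s_def power_mult_distrib[symmetric] power_inverse[symmetric])
    finally have "(\<Prod>i<n + n. s z i) = inverse ((z * cnj z) ^ n)" .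
    moreover have "Determinant.det (M z) = rl_charpoly n R z"
      unfolding M_def rl_charpoly_eq[OF CB] ..
    ultimately show ?thesis
      using det_scale_rows[OF M[of z], of "s z"] by (simp add: field_simps)
  qed
  ultimately show ?thesis by simp
qed


section \<open>The numerical function\<close>

lemma sum_even_powers_pos: "(\<Sum>j\<le>n. cmod z ^ (2 * j)) > 0"
proof -
  have "0 < (\<Sum>j\<in>{0}. cmod z ^ (2 * j))" by simp
  also have "\<dots> \<le> (\<Sum>j\<le>n. cmod z ^ (2 * j))" by (rule sum_mono2) auto
  finally show ?thesis .
qed

lemma numerical_function_eq_0_iff:
  assumes "real_linear_op n R"
  shows "numerical_function n R z = 0 \<longleftrightarrow> rl_charpoly n R z = 0"
  using rl_charpoly_real[OF assms, of z] sum_even_powers_pos[where n = n and z = z]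
  by (auto simp: numerical_function_def complex_is_Real_iff complex_eq_iff)

lemma numerical_function_0:
  assumes R: "real_linear_op n R"
  shows "complex_of_real (numerical_function n R 0) = Determinant.det (complexification n R)"
proof -
  obtain C B where CB: "represents n R C B" using represents_exists[OF R] by blast
  hence "C \<in> carrier_mat n n" by (simp add: represents_def)
  hence "C - 0 \<cdot>\<^sub>m 1\<^sub>m n = C" by (intro eq_matI) auto
  hence "rl_charpoly n R 0 = Determinant.det (complexification n R)"
    by (simp add: rl_charpoly_eq[OF CB] complexification_eq[OF CB])
  moreover have "(\<Sum>j\<le>n. cmod 0 ^ (2 * j)) = (\<Sum>j\<le>n. if j = 0 then 1 else 0)"
    by (intro sum.cong) auto
  ultimately show ?thesis by (simp add: numerical_function_eq[OF R])
qed

lemma tendsto_sum_even_powers: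
  "((\<lambda>z. (\<Sum>j\<le>n. cmod z ^ (2 * j)) / cmod z ^ (2 * n)) \<longlongrightarrow> 1) at_infinity"
proof -
  have "filterlim (\<lambda>z. (cmod z)\<^sup>2) at_infinity at_infinity"
    by (rule filterlim_compose[OF filterlim_power_at_infinity
          filterlim_at_top_imp_at_infinity[OF filterlim_norm_at_top]]) simp
  from filterlim_compose[OF tendsto_poly_over_power_at_infinity this, of "\<lambda>_. 1" n]
  show ?thesis by (simp add: power_mult)
qed

text \<open>Numerator and denominator of \<open>F\<close> are both asymptotic to \<open>\<bar>\<lambda>\<bar>\<^sup>2\<^sup>n\<close>.\<close>

lemma numerical_function_at_infinity:
  assumes R: "real_linear_op n R"
  shows "(numerical_function n R \<longlongrightarrow> 1) at_infinity"
proof -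
  have "((\<lambda>z. Re (rl_charpoly n R z / (z * cnj z) ^ n) /
      ((\<Sum>j\<le>n. cmod z ^ (2 * j)) / cmod z ^ (2 * n))) \<longlongrightarrow> Re 1 / 1) at_infinity"
    by (intro tendsto_divide tendsto_Re rl_charpoly_leading[OF R] tendsto_sum_even_powers) simp
  hence "((\<lambda>z. Re (rl_charpoly n R z / (z * cnj z) ^ n) /
      ((\<Sum>j\<le>n. cmod z ^ (2 * j)) / cmod z ^ (2 * n))) \<longlongrightarrow> 1) at_infinity" by simp
  thus ?thesis
  proof (rule Lim_transform_eventually)
    show "\<forall>\<^sub>F z in at_infinity. Re (rl_charpoly n R z / (z * cnj z) ^ n) /
        ((\<Sum>j\<le>n. cmod z ^ (2 * j)) / cmod z ^ (2 * n)) = numerical_function n R z"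
      using eventually_not_equal_at_infinity[of 0]
    proof eventually_elim
      case (elim z)
      have "(z * cnj z) ^ n = complex_of_real (cmod z ^ (2 * n))"
        by (simp add: complex_norm_square[symmetric] power_mult)
      hence "Re (rl_charpoly n R z / (z * cnj z) ^ n) = Re (rl_charpoly n R z) / cmod z ^ (2 * n)"
        by (simp only: Re_divide_of_real)
      thus ?case using elim by (simp add: numerical_function_def)
    qed
  qed
qed

text \<open>With \<open>v\<close> the vector of powers of \<open>\<lambda>\<close>, the entries of \<open>U v\<close> are the values of the
  polynomials whose coefficients are the rows of \<open>U\<close>.\<close>

lemma mult_mat_vec_powers:
  fixes U :: "complex mat"
  assumes "U \<in> carrier_mat (n + 1) (n + 1)" "i \<le> n"
  shows "(U *\<^sub>v vec (n + 1) (\<lambda>j. z ^ j)) $ i = (\<Sum>j\<le>n. U $$ (i, j) * z ^ j)"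
  using assms by (subst mult_mat_vec_index[of _ "n + 1"]) (auto simp: lessThan_Suc_atMost)

lemma rl_charpoly_diagonalized:
  fixes d :: "nat \<Rightarrow> real"
  assumes R: "real_linear_op n R" and U: "U \<in> carrier_mat (n + 1) (n + 1)"
    and H: "coeff_matrix n R = mat_adjoint U * mat_diag (n + 1) (\<lambda>i. complex_of_real (d i)) * U"
  shows "rl_charpoly n R z =
    complex_of_real (\<Sum>i\<le>n. d i * (cmod (\<Sum>j\<le>n. U $$ (i, j) * z ^ j))\<^sup>2)"
proof -
  let ?H = "coeff_matrix n R" and ?v = "vec (n + 1) (\<lambda>j. z ^ j)"
  have car: "?H \<in> carrier_mat (n + 1) (n + 1)"
    and p: "rl_charpoly n R z = (\<Sum>i\<le>n. \<Sum>j\<le>n. ?H $$ (i, j) * z ^ j * cnj z ^ i)"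
    using coeff_matrix_is_coeff_matrix[OF R] unfolding is_coeff_matrix_def by auto
  have "rl_charpoly n R z = conjugate ?v \<bullet> (?H *\<^sub>v ?v)"
    unfolding p by (subst scalar_prod_mult_mat_vec[OF car])
      (auto simp: lessThan_Suc_atMost mult_ac intro!: sum.cong)
  also have "\<dots> = complex_of_real (\<Sum>i<n + 1. d i * (cmod ((U *\<^sub>v ?v) $ i))\<^sup>2)"
    unfolding H by (rule diagonalized_quadratic_form[OF U]) simp
  also have "(\<Sum>i<n + 1. d i * (cmod ((U *\<^sub>v ?v) $ i))\<^sup>2) =
      (\<Sum>i\<le>n. d i * (cmod (\<Sum>j\<le>n. U $$ (i, j) * z ^ j))\<^sup>2)"
    unfolding Suc_eq_plus1[symmetric] lessThan_Suc_atMost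
    by (intro sum.cong refl) (simp only: mult_mat_vec_powers[OF U, unfolded Suc_eq_plus1[symmetric]] atMost_iff)
  finally show ?thesis .
qed

lemma sum_norm_unitary_polys:
  assumes U: "U \<in> carrier_mat (n + 1) (n + 1)" "unitary_mat U"
  shows "(\<Sum>i\<le>n. (cmod (\<Sum>j\<le>n. U $$ (i, j) * z ^ j))\<^sup>2) = (\<Sum>j\<le>n. cmod z ^ (2 * j))"
proof -
  let ?v = "vec (n + 1) (\<lambda>j. z ^ j)"
  have "(\<Sum>i\<le>n. (cmod (\<Sum>j\<le>n. U $$ (i, j) * z ^ j))\<^sup>2) = (\<Sum>i<n + 1. (cmod ((U *\<^sub>v ?v) $ i))\<^sup>2)"
    unfolding Suc_eq_plus1[symmetric] lessThan_Suc_atMost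
    by (intro sum.cong refl) (simp only: mult_mat_vec_powers[OF U(1), unfolded Suc_eq_plus1[symmetric]] atMost_iff)
  also have "\<dots> = (\<Sum>j<n + 1. (cmod (?v $ j))\<^sup>2)"
    by (rule unitary_mat_isometry[OF U]) simp
  also have "\<dots> = (\<Sum>j\<le>n. cmod z ^ (2 * j))"
    by (intro sum.cong) (auto simp: norm_power power_mult[symmetric] mult.commute)
  finally show ?thesis .
qed

text \<open>Restricting \<open>F\<close> to the nonnegative real axis reduces the claim to the intermediate value
  theorem for functions of a real variable: far out on the axis, \<open>F\<close> exceeds any \<open>y < l\<close>.\<close>

lemma continuous_range_contains_up_to_limit:
  fixes F :: "complex \<Rightarrow> real"
  assumes cont: "continuous_on UNIV F" and lim: "(F \<longlongrightarrow> l) at_infinity"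
  shows "{F 0..<l} \<subseteq> range F"
proof
  fix y assume y: "y \<in> {F 0..<l}"
  let ?g = "\<lambda>t. F (complex_of_real t)"
  have "filterlim complex_of_real at_infinity at_top"
    by (intro filterlim_of_real_at_infinity)
  hence "(?g \<longlongrightarrow> l) at_top" by (rule filterlim_compose[OF lim])
  hence "\<forall>\<^sub>F t in at_top. y < ?g t" using y by (auto intro: order_tendstoD)
  moreover have "\<forall>\<^sub>F t in at_top. (0::real) \<le> t" by (rule eventually_ge_at_top)
  ultimately have "\<forall>\<^sub>F t in at_top. y < ?g t \<and> 0 \<le> t" by (rule eventually_conj)
  then obtain t where t: "y < ?g t" "0 \<le> t" using eventually_happens'[OF trivial_limit_at_top_linorder] by blast
  have "continuous_on {0..t} ?g"
    by (rule continuous_on_compose2[OF cont]) (auto intro: continuous_intros)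
  hence "\<exists>x\<ge>0. x \<le> t \<and> ?g x = y"
    using t y by (intro IVT') auto
  thus "y \<in> range F" by auto
qed

theorem theorem4p4:
  fixes n :: nat
    and R :: "complex vec \<Rightarrow> complex vec"
    and p :: "complex \<Rightarrow> complex"
    and H U :: "complex mat"
    and F :: "complex \<Rightarrow> real"
    and d :: "nat \<Rightarrow> real"
    and q :: "nat \<Rightarrow> complex \<Rightarrow> complex"
  assumes "n \<ge> 1"
    and "real_linear_op n R"
    and "p = rl_charpoly n R"
    and "H = coeff_matrix n R"
    and "F = numerical_function n R"
    and "U \<in> carrier_mat (n + 1) (n + 1)"
    and "unitary_mat U"
    and "H = mat_adjoint U * mat_diag (n + 1) (\<lambda>i. complex_of_real (d i)) * U"
    and "q = (\<lambda>i z. \<Sum>j\<le>n. U $$ (i, j) * z ^ j)"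
  shows
    "(continuous_on UNIV F \<and> complex_of_real ` range F \<subseteq> field_of_values H) \<and>
     (\<forall>z. F z = 0 \<longleftrightarrow> p z = 0) \<and>
     ((\<forall>i\<le>n. eigenvalue H (complex_of_real (d i))) \<and>
      (\<forall>z. (\<forall>i\<le>n. (cmod (q i z))\<^sup>2 / (\<Sum>j\<le>n. (cmod (q j z))\<^sup>2) \<ge> 0) \<and>
           (\<Sum>i\<le>n. (cmod (q i z))\<^sup>2 / (\<Sum>j\<le>n. (cmod (q j z))\<^sup>2)) = 1 \<and>
           F z = (\<Sum>i\<le>n. d i * ((cmod (q i z))\<^sup>2 / (\<Sum>j\<le>n. (cmod (q j z))\<^sup>2))))) \<and>
     (complex_of_real (F 0) = Determinant.det (complexification n R) \<and>
      F 0 = (\<Sum>i\<le>n. d i * (cmod (U $$ (i, 0)))\<^sup>2) \<and>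
      (F \<longlongrightarrow> (\<Sum>i\<le>n. d i * (cmod (U $$ (i, n)))\<^sup>2)) at_infinity \<and>
      (\<Sum>i\<le>n. d i * (cmod (U $$ (i, n)))\<^sup>2) = 1 \<and>
      {Re (Determinant.det (complexification n R))..<1} \<subseteq> range F \<and>
      complex_of_real ` range F \<subseteq> field_of_values H \<and>
      field_of_values H = complex_of_real ` {lambda_min H..lambda_max H})"
proof -
  note R = assms(2) and p = assms(3) and F = assms(5) and U = assms(6,7) and q = assms(9)
  have H: "coeff_matrix n R = mat_adjoint U * mat_diag (n + 1) (\<lambda>i. complex_of_real (d i)) * U"
    using assms(4,8) by simp
  let ?S = "\<lambda>z. \<Sum>j\<le>n. (cmod (q j z))\<^sup>2"
  let ?w = "\<lambda>z i. (cmod (q i z))\<^sup>2 / ?S z"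
  have S: "?S z = (\<Sum>j\<le>n. cmod z ^ (2 * j))" for z
    unfolding q by (rule sum_norm_unitary_polys[OF U])
  have S_pos: "?S z > 0" for z
    unfolding S by (rule sum_even_powers_pos)
  have F_quot: "F z = (\<Sum>i\<le>n. d i * (cmod (q i z))\<^sup>2) / ?S z" for z
    unfolding S unfolding F numerical_function_def rl_charpoly_diagonalized[OF R U(1) H] q by simp
  have F_avg: "F z = (\<Sum>i\<le>n. d i * ?w z i)" for z
    unfolding F_quot by (simp add: sum_divide_distrib)
  have w_nonneg: "?w z i \<ge> 0" for z i
    using S_pos[of z] by simp
  have w_sum: "(\<Sum>i\<le>n. ?w z i) = 1" for z
    using S_pos[of z] by (simp add: sum_divide_distrib[symmetric])

  have fov: "field_of_values H =
      complex_of_real ` {\<Sum>i<n + 1. d i * w i | w. (\<forall>i<n + 1. w i \<ge> 0) \<and> (\<Sum>i<n + 1. w i) = 1}"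
    unfolding assms(8) by (rule field_of_values_unitary_diag[OF U])
  have range_fov: "complex_of_real ` range F \<subseteq> field_of_values H"
    unfolding fov
  proof (intro image_mono, clarify)
    fix z
    show "\<exists>w. F z = (\<Sum>i<n + 1. d i * w i) \<and> (\<forall>i<n + 1. w i \<ge> 0) \<and> (\<Sum>i<n + 1. w i) = 1"
      using F_avg[of z] w_nonneg[of _ z] w_sum[of z]
      unfolding Suc_eq_plus1[symmetric] lessThan_Suc_atMost
      by (intro exI[of _ "?w z"] conjI allI impI)
  qed

  have eig: "eigenvalue H k \<longleftrightarrow> (\<exists>i<n + 1. k = complex_of_real (d i))" for k
    unfolding assms(8) by (rule eigenvalue_unitary_diag_iff[OF U])
  have "{r. eigenvalue H (complex_of_real r)} = d ` {..<n + 1}"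
    unfolding eig by auto
  hence fov_interval: "field_of_values H = complex_of_real ` {lambda_min H..lambda_max H}"
    unfolding fov lambda_min_def lambda_max_def by (subst weighted_averages_eq_interval) auto

  have cont: "continuous_on UNIV F"
  proof -
    have "\<forall>z\<in>UNIV. ?S z \<noteq> 0"
      using S_pos by (intro ballI less_imp_neq[THEN not_sym])
    hence "continuous_on UNIV (\<lambda>z. (\<Sum>i\<le>n. d i * (cmod (q i z))\<^sup>2) / ?S z)"
      unfolding q by (intro continuous_intros)
    moreover have "F = (\<lambda>z. (\<Sum>i\<le>n. d i * (cmod (q i z))\<^sup>2) / ?S z)"
      by (rule ext) (rule F_quot)
    ultimately show ?thesis by simp
  qed

  have F0: "complex_of_real (F 0) = Determinant.det (complexification n R)"
    unfolding F by (rule numerical_function_0[OF R])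
  have q0: "q i 0 = U $$ (i, 0)" for i
  proof -
    have "q i 0 = (\<Sum>j\<le>n. if j = 0 then U $$ (i, 0) else 0)"
      unfolding q by (intro sum.cong) auto
    thus ?thesis by simp
  qed
  have S0: "?S 0 = 1"
  proof -
    have "?S 0 = (\<Sum>j\<le>n. if j = 0 then 1 else 0)"
      unfolding S by (intro sum.cong) auto
    thus ?thesis by simp
  qed
  have F0_sum: "F 0 = (\<Sum>i\<le>n. d i * (cmod (U $$ (i, 0)))\<^sup>2)"
    using F_quot[of 0] unfolding S0 by (simp add: q0)

  have lim1: "(F \<longlongrightarrow> 1) at_infinity"
    unfolding F by (rule numerical_function_at_infinity[OF R])
  have lim: "(F \<longlongrightarrow> (\<Sum>i\<le>n. d i * (cmod (U $$ (i, n)))\<^sup>2)) at_infinity"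
  proof -
    let ?f = "\<lambda>z. (\<Sum>i\<le>n. d i * (cmod (q i z / z ^ n))\<^sup>2) / (?S z / cmod z ^ (2 * n))"
    have "(?f \<longlongrightarrow> (\<Sum>i\<le>n. d i * (cmod (U $$ (i, n)))\<^sup>2) / 1) at_infinity"
      unfolding S unfolding q
      by (intro tendsto_divide tendsto_sum_even_powers tendsto_sum tendsto_mult tendsto_const
          tendsto_power tendsto_norm tendsto_poly_over_power_at_infinity) simp
    hence "(?f \<longlongrightarrow> (\<Sum>i\<le>n. d i * (cmod (U $$ (i, n)))\<^sup>2)) at_infinity" by simp
    moreover have "\<forall>\<^sub>F z in at_infinity. ?f z = F z"
      using eventually_not_equal_at_infinity[of 0]
    proof eventually_elim
      case (elim z)
      have "(\<Sum>i\<le>n. d i * (cmod (q i z / z ^ n))\<^sup>2) =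
          (\<Sum>i\<le>n. d i * (cmod (q i z))\<^sup>2) / cmod z ^ (2 * n)"
        by (simp add: sum_divide_distrib norm_divide norm_power power_divide
            power_mult[symmetric] mult.commute[of n])
      thus ?case using elim by (simp add: F_quot)
    qed
    ultimately show ?thesis by (rule Lim_transform_eventually)
  qed
  have lim_eq: "(\<Sum>i\<le>n. d i * (cmod (U $$ (i, n)))\<^sup>2) = 1"
    by (rule tendsto_unique[OF trivial_limit_at_top_linorder
          filterlim_compose[OF lim filterlim_of_real_at_infinity]
          filterlim_compose[OF lim1 filterlim_of_real_at_infinity]])

  have "Re (Determinant.det (complexification n R)) = F 0"
    unfolding F0[symmetric] by simp
  hence interval: "{Re (Determinant.det (complexification n R))..<1} \<subseteq> range F"
    using continuous_range_contains_up_to_limit[OF cont lim1] by simp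

  have zero: "F z = 0 \<longleftrightarrow> p z = 0" for z
    unfolding F p by (rule numerical_function_eq_0_iff[OF R])
  have eig_d: "\<forall>i\<le>n. eigenvalue H (complex_of_real (d i))"
    unfolding eig by (auto simp: less_Suc_eq_le)
  show ?thesis
    using cont range_fov zero eig_d w_nonneg w_sum F_avg F0 F0_sum lim lim_eq interval fov_interval
    by blast
qed

end
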